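(* For every integer $n\geqslant 2$, the rank of the monoid $\mathcal{PIO}_n$ is $n+1$.
   Context: $\Omega_n=\{1,\ldots,n\}$ with its natural order. A partial transformation of $\Omega_n$ is a map $\alpha$ from a subset $\operatorname{Dom}(\alpha)\subseteq\Omega_n$ (possibly empty) into $\Omega_n$, with image $\operatorname{Im}(\alpha)$. Maps are written on the right and composed from left to right: $x(\alpha\beta)=(x\alpha)\beta$, with $\operatorname{Dom}(\alpha\beta)=\{x\in\operatorname{Dom}(\alpha)\mid x\alpha\in\operatorname{Dom}(\beta)\}$. $\alpha$ is order-preserving if $x\leqslant y$ implies $x\alpha\leqslant y\alpha$ for all $x,y\in\operatorname{Dom}(\alpha)$. A subset $I\subseteq\Omega_n$ (possibly empty) is an interval if for all $x,y,z\in\Omega_n$, $x\leqslant y\leqslant z$ and $x,z\in I$ imply $y\in I$. $\mathcal{PIO}_n$ is the monoid, under composition, of all order-preserving partial transformations $\alpha$ of $\Omega_n$ such that $\operatorname{Dom}(\alpha)$ and $\operatorname{Im}(\alpha)$ are both intervals of $\Omega_n$ (it includes the empty transformation). The rank of a monoid $M$ is the minimum size of a subset $A\subseteq M$ such that the smallest submonoid of $M$ containing $A$ is $M$. *)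

theory Defs
  imports "HOL-Algebra.Group"
begin

definition interval_of :: "nat \<Rightarrow> nat set \<Rightarrow> bool" where
  "interval_of n I \<longleftrightarrow> I \<subseteq> {1..n} \<and>
     (\<forall>x\<in>{1..n}. \<forall>y\<in>{1..n}. \<forall>z\<in>{1..n}. x \<le> y \<and> y \<le> z \<and> x \<in> I \<and> z \<in> I \<longrightarrow> y \<in> I)"

definition order_preserving :: "(nat \<rightharpoonup> nat) \<Rightarrow> bool" where
  "order_preserving a \<longleftrightarrow> mono_on (dom a) (\<lambda>x. the (a x))"

text \<open>
  A partial transformation of \<open>{1..n}\<close> is a map with domain and range contained in \<open>{1..n}\<close>;
  both inclusions are part of \<^const>\<open>interval_of\<close>. Maps act on the right and products are read from
  left to right, so the product of \<open>a\<close> and \<open>b\<close> applies \<open>a\<close> first and is \<open>b \<circ>\<^sub>m a\<close>.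
\<close>

definition PIO :: "nat \<Rightarrow> (nat \<rightharpoonup> nat) monoid" where
  "PIO n = \<lparr>carrier = {a. order_preserving a \<and> interval_of n (dom a) \<and> interval_of n (ran a)},
            mult = (\<lambda>a b. b \<circ>\<^sub>m a),
            one = (\<lambda>x. if x \<in> {1..n} then Some x else None)\<rparr>"

definition submonoid_generated :: "('a, 'b) monoid_scheme \<Rightarrow> 'a set \<Rightarrow> 'a set" where
  "submonoid_generated M A = \<Inter> {H. submonoid H M \<and> A \<subseteq> H}"

text \<open>
  The condition \<open>finite A\<close> is needed because \<^const>\<open>card\<close> is \<open>0\<close> on infinite sets. The value is
  meaningful only for finitely generated monoids, in particular for finite ones.
\<close>

definition monoid_rank :: "('a, 'b) monoid_scheme \<Rightarrow> nat" where
  "monoid_rank M = (LEAST k. \<exists>A. A \<subseteq> carrier M \<and> finite A \<and> card A = k \<and>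
                               submonoid_generated M A = carrier M)"

lemma submonoid_submonoid_generated:
  assumes "monoid M" and "A \<subseteq> carrier M"
  shows "submonoid (submonoid_generated M A) M"
proof -
  interpret monoid M by fact
  have "submonoid (carrier M) M" by unfold_locales auto
  with assms(2) have "submonoid_generated M A \<subseteq> carrier M"
    by (auto simp: submonoid_generated_def)
  then show ?thesis
    by (rule submonoid.intro)
      (auto simp: submonoid_generated_def intro: submonoid.m_closed submonoid.one_closed)
qed

lemma order_preservingD:
  assumes "order_preserving a" "a x = Some u" "a y = Some v" "x \<le> y"
  shows "u \<le> v"
proof -
  have "x \<in> dom a" "y \<in> dom a" using assms(2,3) by (simp_all add: domI)
  from monotone_onD[OF assms(1)[unfolded order_preserving_def] this assms(4)]
  show ?thesis by (simp add: assms(2,3))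
qed

lemma order_preservingI:
  assumes "\<And>x y u v. a x = Some u \<Longrightarrow> a y = Some v \<Longrightarrow> x \<le> y \<Longrightarrow> u \<le> v"
  shows "order_preserving a"
  unfolding order_preserving_def
proof (rule monotone_onI)
  fix x y assume "x \<in> dom a" "y \<in> dom a" "x \<le> y"
  then obtain u v where "a x = Some u" "a y = Some v" by blast
  with assms[OF this \<open>x \<le> y\<close>] show "the (a x) \<le> the (a y)" by simp
qed

lemma interval_ofI:
  assumes "I \<subseteq> {1..n}" "\<And>x y z. x < y \<Longrightarrow> y < z \<Longrightarrow> x \<in> I \<Longrightarrow> z \<in> I \<Longrightarrow> y \<in> I"
  shows "interval_of n I"
proof -
  have "y \<in> I" if "x \<le> y" "y \<le> z" "x \<in> I" "z \<in> I" for x y z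
  proof -
    have "x = y \<or> y = z \<or> x < y \<and> y < z" using that(1,2) by linarith
    then show ?thesis using that(3,4) assms(2) by blast
  qed
  with assms(1) show ?thesis unfolding interval_of_def by (intro conjI ballI impI) blast+
qed

lemma interval_ofD:
  assumes "interval_of n I" "x \<in> I" "z \<in> I" "x \<le> y" "y \<le> z"
  shows "y \<in> I"
proof -
  have I: "I \<subseteq> {1..n}" using assms(1) unfolding interval_of_def by (rule conjunct1)
  then have xz: "x \<in> {1..n}" "z \<in> {1..n}" using assms(2,3) by blast+
  then have "y \<in> {1..n}" using assms(4,5) by simp
  with xz assms show ?thesis unfolding interval_of_def by blast
qed

lemma PIO_mult_closed:
  assumes a: "a \<in> carrier (PIO n)" and b: "b \<in> carrier (PIO n)"
  shows "b \<circ>\<^sub>m a \<in> carrier (PIO n)"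
proof -
  have a: "order_preserving a" "interval_of n (dom a)" "interval_of n (ran a)"
    and b: "order_preserving b" "interval_of n (dom b)" "interval_of n (ran b)"
    using a b by (simp_all add: PIO_def)
  have "order_preserving (b \<circ>\<^sub>m a)"
  proof (rule order_preservingI)
    fix x y u v assume "(b \<circ>\<^sub>m a) x = Some u" "(b \<circ>\<^sub>m a) y = Some v" "x \<le> y"
    then obtain p q where "a x = Some p" "b p = Some u" "a y = Some q" "b q = Some v"
      unfolding map_comp_Some_iff by blast
    with order_preservingD[OF a(1) _ _ \<open>x \<le> y\<close>, of p q] order_preservingD[OF b(1), of p u q v]
    show "u \<le> v" by simp
  qed
  moreover have "interval_of n (dom (b \<circ>\<^sub>m a))"
  proof (rule interval_ofI)
    have "dom (b \<circ>\<^sub>m a) \<subseteq> dom a" by (auto simp: map_comp_Some_iff)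
    then show "dom (b \<circ>\<^sub>m a) \<subseteq> {1..n}" using a(2) unfolding interval_of_def by blast
  next
    fix x y z assume "x < y" "y < z" "x \<in> dom (b \<circ>\<^sub>m a)" "z \<in> dom (b \<circ>\<^sub>m a)"
    then obtain u w where uw: "a x = Some u" "u \<in> dom b" "a z = Some w" "w \<in> dom b"
      unfolding dom_def mem_Collect_eq map_comp_def by (auto split: option.splits)
    have "y \<in> dom a"
      using interval_ofD[OF a(2), of x z y] uw \<open>x < y\<close> \<open>y < z\<close> by auto
    then obtain v where v: "a y = Some v" by auto
    have "u \<le> v" "v \<le> w"
      using order_preservingD[OF a(1) uw(1) v] order_preservingD[OF a(1) v uw(3)]
        \<open>x < y\<close> \<open>y < z\<close> by simp_all
    then have "v \<in> dom b" using interval_ofD[OF b(2) uw(2,4)] by blast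
    with v show "y \<in> dom (b \<circ>\<^sub>m a)" by (auto simp: map_comp_Some_iff)
  qed
  moreover have "interval_of n (ran (b \<circ>\<^sub>m a))"
  proof (rule interval_ofI)
    have "ran (b \<circ>\<^sub>m a) \<subseteq> ran b" by (auto simp: ran_def map_comp_Some_iff)
    then show "ran (b \<circ>\<^sub>m a) \<subseteq> {1..n}" using b(3) unfolding interval_of_def by blast
  next
    fix x y z assume xyz: "x < y" "y < z" "x \<in> ran (b \<circ>\<^sub>m a)" "z \<in> ran (b \<circ>\<^sub>m a)"
    then obtain p u q w where
      uw: "a p = Some u" "b u = Some x" "a q = Some w" "b w = Some z"
      by (auto simp: ran_def map_comp_Some_iff)
    have "x \<in> ran b" "z \<in> ran b" using uw by (auto intro: ranI)
    then have "y \<in> ran b" using interval_ofD[OF b(3), of x z y] xyz by simp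
    then obtain v where v: "b v = Some y" by (auto simp: ran_def)
    have "u \<le> v"
      using order_preservingD[OF b(1) v uw(2)] xyz by linarith
    moreover have "v \<le> w"
      using order_preservingD[OF b(1) uw(4) v] xyz by linarith
    moreover have "u \<in> ran a" "w \<in> ran a" using uw by (auto intro: ranI)
    ultimately have "v \<in> ran a" using interval_ofD[OF a(3)] by blast
    then obtain r where "a r = Some v" by (auto simp: ran_def)
    with v show "y \<in> ran (b \<circ>\<^sub>m a)" by (auto simp: ran_def map_comp_Some_iff)
  qed
  ultimately show ?thesis by (simp add: PIO_def)
qed

lemma PIO_one_closed: "\<one>\<^bsub>PIO n\<^esub> \<in> carrier (PIO n)"
proof -
  let ?e = "\<lambda>x::nat. if x \<in> {1..n} then Some x else None"
  have e: "?e x = Some y \<longleftrightarrow> x \<in> {1..n} \<and> y = x" for x y by auto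
  have "dom ?e = {1..n}" unfolding dom_def by auto
  moreover have "ran ?e = {1..n}" unfolding ran_def e by blast
  moreover have "order_preserving ?e"
    by (rule order_preservingI) (simp only: e)
  moreover have "interval_of n {1..n}" unfolding interval_of_def by blast
  ultimately show ?thesis by (simp add: PIO_def)
qed

lemma monoid_PIO: "monoid (PIO n)"
proof (rule monoidI)
  fix a b assume "a \<in> carrier (PIO n)" "b \<in> carrier (PIO n)"
  then have "b \<circ>\<^sub>m a \<in> carrier (PIO n)" by (rule PIO_mult_closed)
  then show "a \<otimes>\<^bsub>PIO n\<^esub> b \<in> carrier (PIO n)" by (simp add: PIO_def)
next
  show "\<one>\<^bsub>PIO n\<^esub> \<in> carrier (PIO n)" by (rule PIO_one_closed)
next
  fix a b c
  show "a \<otimes>\<^bsub>PIO n\<^esub> b \<otimes>\<^bsub>PIO n\<^esub> c = a \<otimes>\<^bsub>PIO n\<^esub> (b \<otimes>\<^bsub>PIO n\<^esub> c)"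
    by (auto simp: PIO_def map_comp_def fun_eq_iff split: option.splits)
next
  fix a assume "a \<in> carrier (PIO n)"
  then have "interval_of n (dom a)" "interval_of n (ran a)" by (simp_all add: PIO_def)
  then have *: "dom a \<subseteq> {1..n}" "ran a \<subseteq> {1..n}" unfolding interval_of_def by blast+
  show "\<one>\<^bsub>PIO n\<^esub> \<otimes>\<^bsub>PIO n\<^esub> a = a"
  proof (rule ext)
    fix x
    have "a x = None" if "x \<notin> {1..n}" using that *(1) by blast
    then show "(\<one>\<^bsub>PIO n\<^esub> \<otimes>\<^bsub>PIO n\<^esub> a) x = a x" by (simp add: PIO_def map_comp_def)
  qed
  show "a \<otimes>\<^bsub>PIO n\<^esub> \<one>\<^bsub>PIO n\<^esub> = a"
  proof (rule ext)
    fix x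
    have "y \<in> {1..n}" if "a x = Some y" for y using that *(2) by (blast intro: ranI)
    then show "(a \<otimes>\<^bsub>PIO n\<^esub> \<one>\<^bsub>PIO n\<^esub>) x = a x"
      by (cases "a x") (simp_all add: PIO_def map_comp_def)
  qed
qed

lemma finite_carrier_PIO: "finite (carrier (PIO n))"
proof (rule finite_subset)
  let ?F = "\<lambda>D. {a. dom a = D \<and> ran a \<subseteq> {1..n}}"
  show "carrier (PIO n) \<subseteq> (\<Union>D\<in>Pow {1..n}. ?F D)"
  proof
    fix a assume "a \<in> carrier (PIO n)"
    then have "interval_of n (dom a)" "interval_of n (ran a)" by (simp_all add: PIO_def)
    then have "dom a \<in> Pow {1..n}" "ran a \<subseteq> {1..n}" unfolding interval_of_def by blast+
    then show "a \<in> (\<Union>D\<in>Pow {1..n}. ?F D)" by blast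
  qed
  show "finite (\<Union>D\<in>Pow {1..n}. ?F D)"
  proof (rule finite_UN_I)
    show "finite (Pow {1..n})" by simp
    fix D assume "D \<in> Pow {1..n}"
    then have "finite D" using finite_subset by blast
    then show "finite (?F D)" by (rule finite_set_of_finite_maps) simp
  qed
qed

end

theory Submission
  imports Defs
begin

text \<open>
  Only the identity has \<open>n\<close> points in its image, so a product of two elements other than the
  identity has at most \<open>n - 1\<close>, and if it has exactly \<open>n - 1\<close>, its first factor already has that
  rank and the same kernel (\<open>kernel_mult\<close>; the kernel also records the domain). Hence every kernel
  of an element of rank \<open>n - 1\<close> is the kernel of a member of any generating set
  (\<open>kernel_of_generator\<close>). There are \<open>n + 1\<close> such kernels: the domain omits \<open>1\<close>, or it
  omits \<open>n\<close>, or it is everything and exactly one pair \<open>i, i + 1\<close> is identified. This is the lower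
  bound.

  The generating set that attains it takes one element for each kernel: the two shifts
  \<open>x \<mapsto> x - 1\<close> and \<open>x \<mapsto> x + 1\<close>, and the collapses of \<open>i, i + 1\<close> onto \<open>{1..n - 1}\<close>. Shifting back
  and forth restricts the identity to any interval. A full map onto an initial segment factors into
  collapses, because peeling off a collapse enlarges the image by one (\<open>full_map_in_submonoid\<close>).
  Any nonempty element with domain \<open>{a..b}\<close> and least value \<open>c\<close> is the identity on \<open>{a..b}\<close>,
  followed by a full map onto an initial segment, followed by the shift by \<open>c - 1\<close>; the empty
  element is the \<open>n\<close>-th power of a shift.
\<close>

section \<open>Maps with steps zero and one\<close>

text \<open>
  Since the image of an element is an interval, an element increases by at most one at each step.
  Conversely, cutting a map with this property down to \<open>{1..n}\<close> gives an element
  (\<open>pmap_in_PIO\<close>), so total functions on the natural numbers can stand for partial maps.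
\<close>
definition slow :: "(nat \<Rightarrow> nat) \<Rightarrow> bool" where
  "slow f \<longleftrightarrow> (\<forall>x. f x \<le> f (Suc x) \<and> f (Suc x) \<le> Suc (f x))"

definition pmap :: "nat \<Rightarrow> (nat \<Rightarrow> nat) \<Rightarrow> (nat \<rightharpoonup> nat)" where
  "pmap n f = (\<lambda>x. if x \<in> {1..n} \<and> f x \<in> {1..n} then Some (f x) else None)"

lemma pmap_eq_Some_iff: "pmap n f x = Some y \<longleftrightarrow> x \<in> {1..n} \<and> y \<in> {1..n} \<and> y = f x"
  by (auto simp: pmap_def)

lemma slow_mono: "slow f \<Longrightarrow> x \<le> y \<Longrightarrow> f x \<le> f y"
  by (rule lift_Suc_mono_le) (auto simp: slow_def)

lemma slow_intermediate_value:
  assumes "slow f" "p \<le> q" "f p \<le> y" "y \<le> f q"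
  shows "\<exists>r\<in>{p..q}. f r = y"
  using assms(2,4)
proof (induction q rule: dec_induct)
  case base
  with assms(3) show ?case by auto
next
  case (step q)
  show ?case
  proof (cases "y \<le> f q")
    case True
    with step.IH show ?thesis by force
  next
    case False
    have "f (Suc q) \<le> Suc (f q)" using assms(1) by (simp add: slow_def)
    with False step.prems have "f (Suc q) = y" by simp
    with step.hyps(1) show ?thesis by auto
  qed
qed

lemma pmap_in_PIO:
  assumes "slow f"
  shows "pmap n f \<in> carrier (PIO n)"
proof -
  have "order_preserving (pmap n f)"
    by (rule order_preservingI) (use slow_mono[OF assms] in \<open>auto simp: pmap_eq_Some_iff\<close>)
  moreover have "interval_of n (dom (pmap n f))"
  proof (rule interval_ofI)
    fix x y z assume *: "x < y" "y < z" "x \<in> dom (pmap n f)" "z \<in> dom (pmap n f)"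
    have "f x \<le> f y" "f y \<le> f z" using slow_mono[OF assms] * by auto
    with * show "y \<in> dom (pmap n f)" by (auto simp: dom_def pmap_eq_Some_iff)
  qed (auto simp: dom_def pmap_eq_Some_iff)
  moreover have "interval_of n (ran (pmap n f))"
  proof (rule interval_ofI)
    fix x y z assume *: "x < y" "y < z" "x \<in> ran (pmap n f)" "z \<in> ran (pmap n f)"
    then obtain p q where pq: "p \<in> {1..n}" "f p = x" "q \<in> {1..n}" "f q = z"
      "x \<in> {1..n}" "z \<in> {1..n}"
      by (auto simp: ran_def pmap_eq_Some_iff)
    have "p \<le> q" using slow_mono[OF assms, of q p] pq * by linarith
    then obtain r where "r \<in> {p..q}" "f r = y"
      using slow_intermediate_value[OF assms, of p q y] pq * by auto
    with pq * have "pmap n f r = Some y" by (auto simp: pmap_eq_Some_iff)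
    then show "y \<in> ran (pmap n f)" by (rule ranI)
  qed (auto simp: ran_def pmap_eq_Some_iff)
  ultimately show ?thesis by (simp add: PIO_def)
qed

lemma mult_PIO_apply:
  "(a \<otimes>\<^bsub>PIO n\<^esub> b) x = (case a x of None \<Rightarrow> None | Some y \<Rightarrow> b y)"
  by (simp add: PIO_def map_comp_def)

lemma one_PIO: "\<one>\<^bsub>PIO n\<^esub> = pmap n (\<lambda>x. x)"
  by (auto simp: PIO_def pmap_def)

section \<open>A generating set with n + 1 elements\<close>

text \<open>
  For \<open>i = 0\<close> the formula of the collapse gives the downward shift: the value \<open>0\<close> at \<open>1\<close> lies
  outside \<open>{1..n}\<close>, so \<open>1\<close> drops out of the domain. At \<open>i = n\<close> it would give a partial identity,
  whose powers are all equal; the upward shift has the same kernel.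
\<close>
definition gen :: "nat \<Rightarrow> nat \<Rightarrow> (nat \<rightharpoonup> nat)" where
  "gen n i = pmap n (if i = n then Suc else (\<lambda>x. if x \<le> i then x else x - 1))"

lemma gen_in_PIO: "gen n i \<in> carrier (PIO n)"
  unfolding gen_def by (rule pmap_in_PIO) (auto simp: slow_def)

locale submonoid_with_gens =
  fixes n :: nat and H :: "(nat \<rightharpoonup> nat) set"
  assumes n2: "n \<ge> 2"
    and submonoid: "submonoid H (PIO n)"
    and gen_in: "i \<le> n \<Longrightarrow> gen n i \<in> H"
begin

lemma mult_in: "a \<in> H \<Longrightarrow> b \<in> H \<Longrightarrow> a \<otimes>\<^bsub>PIO n\<^esub> b \<in> H"
  using submonoid by (rule submonoid.m_closed)

lemma one_in: "pmap n (\<lambda>x. x) \<in> H"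
  using submonoid.one_closed[OF submonoid] by (simp add: one_PIO)

lemma shift_up_in: "pmap n (\<lambda>x. x + k) \<in> H"
proof (induction k)
  case 0
  then show ?case using one_in by simp
next
  case (Suc k)
  have "pmap n (\<lambda>x. x + k) \<otimes>\<^bsub>PIO n\<^esub> gen n n = pmap n (\<lambda>x. x + Suc k)"
    by (auto simp: fun_eq_iff mult_PIO_apply gen_def pmap_def)
  then show ?case using mult_in[OF Suc gen_in[of n]] by simp
qed

lemma shift_down_in: "pmap n (\<lambda>x. x - k) \<in> H"
proof (induction k)
  case 0
  then show ?case using one_in by simp
next
  case (Suc k)
  have "pmap n (\<lambda>x. x - k) \<otimes>\<^bsub>PIO n\<^esub> gen n 0 = pmap n (\<lambda>x. x - Suc k)"
    using n2 by (auto simp: fun_eq_iff mult_PIO_apply gen_def pmap_def)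
  then show ?case using mult_in[OF Suc gen_in[of 0]] by simp
qed

text \<open>
  Shifting down by \<open>a - 1\<close> and back pushes the points below \<open>a\<close> out of range; shifting up by
  \<open>n - b\<close> and back does the same to the points above \<open>b\<close>.
\<close>
lemma partial_identity_in:
  assumes "1 \<le> a" "b \<le> n"
  shows "(\<lambda>x. if x \<in> {a..b} then Some x else None) \<in> H"
proof -
  let ?d = "pmap n (\<lambda>x. x - (a - 1)) \<otimes>\<^bsub>PIO n\<^esub> pmap n (\<lambda>x. x + (a - 1))"
  let ?u = "pmap n (\<lambda>x. x + (n - b)) \<otimes>\<^bsub>PIO n\<^esub> pmap n (\<lambda>x. x - (n - b))"
  have "?d = (\<lambda>x. if x \<in> {a..n} then Some x else None)"
    using assms by (auto simp: fun_eq_iff mult_PIO_apply pmap_def)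
  moreover have "?u = (\<lambda>x. if x \<in> {1..b} then Some x else None)"
    using assms by (auto simp: fun_eq_iff mult_PIO_apply pmap_def)
  ultimately have eq: "?d \<otimes>\<^bsub>PIO n\<^esub> ?u = (\<lambda>x. if x \<in> {a..b} then Some x else None)"
    using assms by (auto simp: fun_eq_iff mult_PIO_apply)
  show ?thesis
    unfolding eq[symmetric] by (intro mult_in shift_down_in shift_up_in)
qed

text \<open>
  If \<open>f i = f (i + 1)\<close>, then \<open>f\<close> is the collapse of \<open>i, i + 1\<close> followed by \<open>f\<close> with the repeated
  value left out. As \<open>f\<close> has slope one from \<open>n\<close> on, leaving out one value raises the value at \<open>n\<close>
  by one, which makes \<open>n - f n\<close> a measure for the induction.
\<close>
lemma full_map_in_submonoid:
  assumes "slow f" "f 1 = 1" "\<And>x. x \<ge> n \<Longrightarrow> f (Suc x) = Suc (f x)"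
  shows "pmap n f \<in> H"
  using assms
proof (induction "n - f n" arbitrary: f rule: less_induct)
  case less
  note slow = \<open>slow f\<close>
  have steps: "f x \<le> f (Suc x)" "f (Suc x) \<le> Suc (f x)" for x
    using slow by (auto simp: slow_def)
  show ?case
  proof (cases "\<exists>i\<in>{1..<n}. f (Suc i) = f i")
    case True
    then obtain i where i: "1 \<le> i" "i < n" "f (Suc i) = f i" by auto
    define g where "g = (\<lambda>x. if x \<le> i then f x else f (Suc x))"
    have bound: "f x \<le> x" if "1 \<le> x" for x
      using that
    proof (induction x rule: dec_induct)
      case base
      then show ?case using less.prems(2) by simp
    next
      case (step x)
      then show ?case using steps(2)[of x] by linarith
    qed
    \<comment> \<open>The repeated value costs one step, so that \<open>f n < n\<close> and the measure really drops.\<close>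
    have "f x < x" if "Suc i \<le> x" for x
      using that
    proof (induction x rule: dec_induct)
      case base
      then show ?case using bound[OF i(1)] i(3) by simp
    next
      case (step x)
      then show ?case using steps(2)[of x] by linarith
    qed
    from this[of n] have "n - g n < n - f n"
      using i less.prems(3)[of n] by (simp add: g_def)
    moreover have "slow g"
      unfolding slow_def
    proof
      fix x
      show "g x \<le> g (Suc x) \<and> g (Suc x) \<le> Suc (g x)"
        using steps[of x] steps[of "Suc x"] i(3) by (cases "x = i") (auto simp: g_def)
    qed
    moreover have "g 1 = 1" using less.prems(2) i by (simp add: g_def)
    moreover have "g (Suc x) = Suc (g x)" if "x \<ge> n" for x
      using less.prems(3)[of "Suc x"] i(2) that by (simp add: g_def)
    ultimately have "pmap n g \<in> H" by (rule less.hyps)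
    moreover have "gen n i \<otimes>\<^bsub>PIO n\<^esub> pmap n g = pmap n f"
    proof
      fix x
      show "(gen n i \<otimes>\<^bsub>PIO n\<^esub> pmap n g) x = pmap n f x"
        using i by (cases "x = Suc i") (auto simp: mult_PIO_apply gen_def pmap_def g_def)
    qed
    ultimately show ?thesis using mult_in gen_in[of i] i by fastforce
  next
    case False
    have "f x = x" if "1 \<le> x" "x \<le> n" for x
      using that
    proof (induction x rule: dec_induct)
      case base
      then show ?case using less.prems(2) by simp
    next
      case (step x)
      then have "x \<in> {1..<n}" by simp
      then have "f (Suc x) \<noteq> f x" using False by blast
      moreover have "f x = x" using step by simp
      ultimately show ?case using steps[of x] by linarith
    qed
    then have "pmap n f = pmap n (\<lambda>x. x)" by (auto simp: pmap_def fun_eq_iff)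
    then show ?thesis using one_in by simp
  qed
qed

lemma PIO_subset: "carrier (PIO n) \<subseteq> H"
proof
  fix \<alpha> assume \<alpha>: "\<alpha> \<in> carrier (PIO n)"
  then have ord: "order_preserving \<alpha>" and idom: "interval_of n (dom \<alpha>)"
    and iran: "interval_of n (ran \<alpha>)" by (simp_all add: PIO_def)
  have sub: "dom \<alpha> \<subseteq> {1..n}" "ran \<alpha> \<subseteq> {1..n}"
    using idom iran unfolding interval_of_def by blast+
  show "\<alpha> \<in> H"
  proof (cases "dom \<alpha> = {}")
    case True
    then have "\<alpha> = pmap n (\<lambda>x. x + n)" by (auto simp: pmap_def fun_eq_iff)
    then show ?thesis using shift_up_in[of n] by simp
  next
    case False
    have fin: "finite (dom \<alpha>)" using sub(1) finite_subset by blast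
    define a where "a = Min (dom \<alpha>)"
    define b where "b = Max (dom \<alpha>)"
    have "a \<in> dom \<alpha>" "b \<in> dom \<alpha>" using fin False by (simp_all add: a_def b_def)
    have dom: "dom \<alpha> = {a..b}"
    proof
      show "dom \<alpha> \<subseteq> {a..b}"
        using fin unfolding a_def b_def by (meson Max_ge Min_le atLeastAtMost_iff subsetI)
      show "{a..b} \<subseteq> dom \<alpha>"
        using interval_ofD[OF idom \<open>a \<in> dom \<alpha>\<close> \<open>b \<in> dom \<alpha>\<close>] by (meson atLeastAtMost_iff subsetI)
    qed
    have ab: "1 \<le> a" "a \<le> b" "b \<le> n"
      using \<open>a \<in> dom \<alpha>\<close> \<open>b \<in> dom \<alpha>\<close> sub(1) dom by auto
    define h where "h = (\<lambda>x. the (\<alpha> x))"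
    have h: "\<alpha> x = Some (h x)" "h x \<in> ran \<alpha>" if "x \<in> {a..b}" for x
    proof -
      from that obtain y where "\<alpha> x = Some y" using dom by blast
      then show "\<alpha> x = Some (h x)" "h x \<in> ran \<alpha>" by (auto simp: h_def intro: ranI)
    qed
    have None: "\<alpha> x = None" if "x \<notin> {a..b}" for x using that dom by blast
    have mono: "h x \<le> h y" if "x \<in> {a..b}" "y \<in> {a..b}" "x \<le> y" for x y
      using order_preservingD[OF ord h(1)[OF that(1)] h(1)[OF that(2)] that(3)] .
    \<comment> \<open>A jump by two would leave a gap in the image.\<close>
    have step: "h (Suc x) \<le> Suc (h x)" if "a \<le> x" "x < b" for x
    proof (rule ccontr)
      assume jump: "\<not> h (Suc x) \<le> Suc (h x)"
      have "Suc (h x) \<in> ran \<alpha>"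
        using interval_ofD[OF iran, of "h x" "h (Suc x)" "Suc (h x)"] h(2) that jump by simp
      then obtain p where p: "\<alpha> p = Some (Suc (h x))" by (auto simp: ran_def)
      then have p': "p \<in> {a..b}" using dom by blast
      then have "h p = Suc (h x)" using p h(1) by simp
      then show False
        using mono[of p x] mono[of "Suc x" p] p' that jump by (cases "p \<le> x") auto
    qed
    define c where "c = h a"
    have c: "1 \<le> c" "c \<le> n" using h(2)[of a] sub(2) ab by (auto simp: c_def)
    have c_le: "c \<le> h x" if "x \<in> {a..b}" for x using mono[of a x] that by (simp add: c_def)
    \<comment> \<open>The values outside \<open>{a..b}\<close> do not affect the product; slope one above \<open>b\<close>, hence
      above \<open>n\<close>, is the form for which full maps have been factored into collapses.\<close>
    define f where "f = (\<lambda>x. if x \<le> a then 1 else if x \<le> b then Suc (h x) - c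
      else Suc (h b) - c + (x - b))"
    have f_beyond: "f x = Suc (h b) - c + (x - b)" if "b \<le> x" for x
      using that ab(2) by (cases "x = b") (auto simp: f_def c_def)
    have "slow f"
      unfolding slow_def
    proof
      fix x
      consider "x < a" | "a \<le> x" "x < b" | "b \<le> x" by linarith
      then show "f x \<le> f (Suc x) \<and> f (Suc x) \<le> Suc (f x)"
      proof cases
        case 1
        then show ?thesis by (simp add: f_def)
      next
        case 2
        have "f x = Suc (h x) - c" using 2 by (auto simp: f_def c_def)
        moreover have "f (Suc x) = Suc (h (Suc x)) - c" using 2 by (simp add: f_def)
        ultimately show ?thesis
          using step[of x] mono[of x "Suc x"] c_le[of x] 2 by (simp add: le_diff_conv diff_le_mono)
      next
        case 3
        then have "f (Suc x) = Suc (f x)" by (simp add: f_beyond Suc_diff_le)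
          then show ?thesis by simp
      qed
    qed
    moreover have "f 1 = 1" using ab by (simp add: f_def)
    moreover have "f (Suc x) = Suc (f x)" if "x \<ge> n" for x
      using that ab(3) by (simp add: f_beyond)
    ultimately have f_in: "pmap n f \<in> H" by (rule full_map_in_submonoid)
    let ?e = "\<lambda>x. if x \<in> {a..b} then Some x else None"
    have eq: "?e \<otimes>\<^bsub>PIO n\<^esub> pmap n f \<otimes>\<^bsub>PIO n\<^esub> pmap n (\<lambda>x. x + (c - 1)) = \<alpha>"
    proof
      fix x
      show "(?e \<otimes>\<^bsub>PIO n\<^esub> pmap n f \<otimes>\<^bsub>PIO n\<^esub> pmap n (\<lambda>x. x + (c - 1))) x = \<alpha> x"
      proof (cases "x \<in> {a..b}")
        case True
        have fx: "f x = Suc (h x) - c" using True by (auto simp: f_def c_def)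
        have "h x \<in> {1..n}" using h(2)[OF True] sub(2) by auto
        moreover have "f x \<in> {1..n}" "f x + (c - 1) = h x"
          unfolding fx using \<open>h x \<in> {1..n}\<close> c c_le[OF True] by simp_all linarith+
        moreover have "x \<in> {1..n}" using True ab by simp
        ultimately show ?thesis
          using True h(1)[OF True] by (simp add: mult_PIO_apply pmap_def)
      next
        case False
        then show ?thesis by (auto simp: mult_PIO_apply None)
      qed
    qed
    show ?thesis
      unfolding eq[symmetric] by (intro mult_in partial_identity_in[OF ab(1,3)] f_in shift_up_in)
  qed
qed

end

lemma gens_generate_PIO:
  assumes "n \<ge> 2"
  shows "submonoid_generated (PIO n) (gen n ` {0..n}) = carrier (PIO n)"
proof
  have "submonoid (carrier (PIO n)) (PIO n)"
    using monoid.m_closed[OF monoid_PIO] monoid.one_closed[OF monoid_PIO]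
    by (intro submonoid.intro) auto
  then show "submonoid_generated (PIO n) (gen n ` {0..n}) \<subseteq> carrier (PIO n)"
    using gen_in_PIO by (auto simp: submonoid_generated_def)
  show "carrier (PIO n) \<subseteq> submonoid_generated (PIO n) (gen n ` {0..n})"
    unfolding submonoid_generated_def
  proof (rule Inter_greatest)
    fix H assume "H \<in> {H. submonoid H (PIO n) \<and> gen n ` {0..n} \<subseteq> H}"
    then interpret submonoid_with_gens n H
      using assms by (intro submonoid_with_gens.intro) auto
    show "carrier (PIO n) \<subseteq> H" by (rule PIO_subset)
  qed
qed

section \<open>Kernels and the lower bound\<close>

definition map_kernel :: "('a \<rightharpoonup> 'b) \<Rightarrow> ('a \<times> 'a) set" where
  "map_kernel a = {(x, y). x \<in> dom a \<and> a x = a y}"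

lemma ran_map_comp_subset: "Some ` ran (b \<circ>\<^sub>m a) \<subseteq> b ` ran a"
  by (force simp: ran_def map_comp_Some_iff image_iff)

lemma card_ran_map_comp_le:
  assumes "finite (ran a)"
  shows "card (ran (b \<circ>\<^sub>m a)) \<le> card (ran a)"
proof -
  have "card (ran (b \<circ>\<^sub>m a)) = card (Some ` ran (b \<circ>\<^sub>m a))" by (simp add: card_image)
  also have "\<dots> \<le> card (b ` ran a)" using ran_map_comp_subset[of b a] assms by (intro card_mono) auto
  also have "\<dots> \<le> card (ran a)" using assms by (rule card_image_le)
  finally show ?thesis .
qed

text \<open>
  If the second factor does not lower the rank, it must be defined and injective on the image of the
  first.
\<close>
lemma kernel_mult:
  assumes fin: "finite (ran a)" and card: "card (ran a) \<le> card (ran (b \<circ>\<^sub>m a))"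
  shows "map_kernel (b \<circ>\<^sub>m a) = map_kernel a"
proof -
  have card_Some: "card (Some ` ran (b \<circ>\<^sub>m a)) = card (ran (b \<circ>\<^sub>m a))" by (simp add: card_image)
  have le: "card (b ` ran a) \<le> card (ran a)" using fin by (rule card_image_le)
  have eq: "Some ` ran (b \<circ>\<^sub>m a) = b ` ran a"
    using fin le card card_Some by (intro card_seteq ran_map_comp_subset) auto
  have "inj_on b (ran a)"
    using fin le card card_Some eq by (intro eq_card_imp_inj_on) auto
  then have inj: "u = v" if "a x = Some u" "a y = Some v" "b u = b v" for x y u v
    using that by (auto simp: inj_on_def intro: ranI)
  have total: "b u \<noteq> None" if "a x = Some u" for x u
  proof -
    have "b u \<in> b ` ran a" using that by (auto intro: ranI)
    then show ?thesis using eq[symmetric] by auto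
  qed
  have "(x, y) \<in> map_kernel (b \<circ>\<^sub>m a) \<longleftrightarrow> (x, y) \<in> map_kernel a" for x y
  proof (cases "a x")
    case None
    then show ?thesis by (simp add: map_kernel_def dom_def map_comp_def)
  next
    case (Some u)
    show ?thesis
    proof (cases "a y")
      case None
      then show ?thesis using Some total[OF Some]
        by (auto simp: map_kernel_def dom_def map_comp_def)
    next
      fix v assume "a y = Some v"
      then show ?thesis using Some total[OF Some] inj[OF Some \<open>a y = Some v\<close>]
        by (auto simp: map_kernel_def dom_def map_comp_def)
    qed
  qed
  then show ?thesis by auto
qed

lemma PIO_dom_ran:
  assumes "a \<in> carrier (PIO n)"
  shows "dom a \<subseteq> {1..n}" "ran a \<subseteq> {1..n}" "finite (dom a)" "finite (ran a)"
proof -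
  have "interval_of n (dom a)" "interval_of n (ran a)" using assms by (simp_all add: PIO_def)
  then show "dom a \<subseteq> {1..n}" "ran a \<subseteq> {1..n}" unfolding interval_of_def by blast+
  then show "finite (dom a)" "finite (ran a)" using finite_subset by blast+
qed

text \<open>
  By counting, such an element is a bijection of \<open>{1..n}\<close>, and a finite chain has no other
  order automorphism.
\<close>
lemma full_rank_eq_one:
  assumes a: "a \<in> carrier (PIO n)" and card: "card (ran a) \<ge> n"
  shows "a = \<one>\<^bsub>PIO n\<^esub>"
proof -
  note sub = PIO_dom_ran[OF a]
  have ord: "order_preserving a" using a by (simp add: PIO_def)
  have ran: "ran a = {1..n}" using sub card by (intro card_seteq) auto
  have Some_ran: "a ` dom a = Some ` ran a" by (force simp: ran_def)
  then have card_im: "card (a ` dom a) = card (ran a)" by (simp add: card_image)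
  have "card (a ` dom a) \<le> card (dom a)" using sub by (intro card_image_le)
  then have dom: "dom a = {1..n}" using sub card card_im by (intro card_seteq) auto
  have inj: "inj_on a (dom a)"
    using sub card_im ran dom by (intro eq_card_imp_inj_on) auto
  have fixed: "a x = Some x" if "x \<in> {1..n}" for x
    using that
  proof (induction x rule: less_induct)
    case (less x)
    have "x \<in> ran a" using less.prems ran by simp
    then obtain y where y: "a y = Some x" by (auto simp: ran_def)
    then have "y \<in> {1..n}" using dom by blast
    then have "x \<le> y" using less.IH[of y] y by (cases "y < x") auto
    have "x \<in> dom a" using less.prems dom by simp
    then obtain z where z: "a x = Some z" by blast
    then have "z \<in> {1..n}" using ran by (blast intro: ranI)
    have "z \<le> x" using order_preservingD[OF ord z y \<open>x \<le> y\<close>] .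
    moreover have "\<not> z < x"
    proof
      assume "z < x"
      then have "a z = a x" using less.IH[of z] \<open>z \<in> {1..n}\<close> z by simp
      then have "z = x" using inj_onD[OF inj] \<open>z \<in> {1..n}\<close> less.prems unfolding dom by blast
      with \<open>z < x\<close> show False by simp
    qed
    ultimately show ?case using z by simp
  qed
  show ?thesis
  proof
    fix x
    have "a x = None" if "x \<notin> {1..n}" using that dom by blast
    then show "a x = \<one>\<^bsub>PIO n\<^esub> x" using fixed[of x] by (cases "x \<in> {1..n}") (auto simp: PIO_def)
  qed
qed

text \<open>
  The elements that are the identity, or have rank below \<open>n - 1\<close>, or share their kernel with a
  member of \<open>A\<close>, form a submonoid containing \<open>A\<close>.
\<close>
lemma kernel_of_generator:
  assumes A: "A \<subseteq> carrier (PIO n)" "submonoid_generated (PIO n) A = carrier (PIO n)"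
    and t: "t \<in> carrier (PIO n)" "t \<noteq> \<one>\<^bsub>PIO n\<^esub>" "card (ran t) \<ge> n - 1"
  shows "\<exists>a\<in>A. map_kernel a = map_kernel t"
proof -
  let ?P = "{h \<in> carrier (PIO n). h = \<one>\<^bsub>PIO n\<^esub> \<or> card (ran h) < n - 1 \<or>
    (\<exists>a\<in>A. map_kernel a = map_kernel h)}"
  have "submonoid ?P (PIO n)"
  proof
    show "?P \<subseteq> carrier (PIO n)" by auto
    show "\<one>\<^bsub>PIO n\<^esub> \<in> ?P" using monoid.one_closed[OF monoid_PIO] by auto
    fix h k assume h: "h \<in> ?P" and k: "k \<in> ?P"
    have carr: "h \<otimes>\<^bsub>PIO n\<^esub> k \<in> carrier (PIO n)"
      using monoid.m_closed[OF monoid_PIO] h k by blast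
    have hk: "h \<otimes>\<^bsub>PIO n\<^esub> k = k \<circ>\<^sub>m h" by (simp add: PIO_def)
    have fin: "finite (ran h)" using PIO_dom_ran(4) h by blast
    show "h \<otimes>\<^bsub>PIO n\<^esub> k \<in> ?P"
    proof (cases "h = \<one>\<^bsub>PIO n\<^esub> \<or> card (ran (k \<circ>\<^sub>m h)) < n - 1")
      case True
      then show ?thesis using carr hk monoid.l_one[OF monoid_PIO, of k n] k by auto
    next
      case False
      then have "card (ran h) < n" using full_rank_eq_one[of h n] h by force
      with False have "map_kernel (k \<circ>\<^sub>m h) = map_kernel h" using fin by (intro kernel_mult) auto
      moreover have "\<not> card (ran h) < n - 1" using card_ran_map_comp_le[OF fin, of k] False by simp
      ultimately show ?thesis using carr hk h False by auto
    qed
  qed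
  moreover have "A \<subseteq> ?P" using A(1) by auto
  ultimately have "submonoid_generated (PIO n) A \<subseteq> ?P"
    unfolding submonoid_generated_def by (intro Inter_lower) blast
  then show ?thesis using A(2) t by auto
qed

lemma card_ran_gen:
  assumes "n \<ge> 2" "i \<le> n"
  shows "card (ran (gen n i)) = n - 1"
proof (cases "i = n")
  case True
  have "ran (gen n i) = {2..n}"
  proof
    show "{2..n} \<subseteq> ran (gen n i)"
    proof
      fix y assume "y \<in> {2..n}"
      then have "gen n i (y - 1) = Some y" using True by (auto simp: gen_def pmap_eq_Some_iff)
      then show "y \<in> ran (gen n i)" by (rule ranI)
    qed
  qed (use True in \<open>auto simp: ran_def gen_def pmap_eq_Some_iff\<close>)
  then show ?thesis by simp
next
  case False
  have "ran (gen n i) = {1..n - 1}"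
  proof
    show "{1..n - 1} \<subseteq> ran (gen n i)"
    proof
      fix y assume "y \<in> {1..n - 1}"
      then have "gen n i (if y \<le> i then y else Suc y) = Some y"
        using False by (auto simp: gen_def pmap_eq_Some_iff)
      then show "y \<in> ran (gen n i)" by (rule ranI)
    qed
  qed (use False assms in \<open>auto simp: ran_def gen_def pmap_eq_Some_iff split: if_splits\<close>)
  then show ?thesis by simp
qed

lemma inj_on_kernel_gen:
  assumes "n \<ge> 2"
  shows "inj_on (\<lambda>i. map_kernel (gen n i)) {0..n}"
proof (rule inj_onI)
  fix i j assume ij: "i \<in> {0..n}" "j \<in> {0..n}" and eq: "map_kernel (gen n i) = map_kernel (gen n j)"
  have k: "(x, x) \<in> map_kernel (gen n l) \<longleftrightarrow> x \<in> dom (gen n l)" for x l by (simp add: map_kernel_def)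
  have zero: "(1, 1) \<in> map_kernel (gen n l) \<longleftrightarrow> l \<noteq> 0" if "l \<le> n" for l
    unfolding k using assms that by (auto simp: dom_def gen_def pmap_def)
  have top: "(n, n) \<in> map_kernel (gen n l) \<longleftrightarrow> l \<noteq> n" if "l \<le> n" for l
    unfolding k using assms that by (auto simp: dom_def gen_def pmap_def)
  have mid: "(m, Suc m) \<in> map_kernel (gen n l) \<longleftrightarrow> l = m" if "l \<le> n" "1 \<le> m" "m < n" for l m
    using assms that by (auto simp: map_kernel_def dom_def gen_def pmap_def)
  have le: "i \<le> n" "j \<le> n" using ij by auto
  consider "i = 0" | "i = n" | "1 \<le> i" "i < n" using le(1) by linarith
  then show "i = j"
  proof cases
    case 1
    then show ?thesis using zero[OF le(1)] zero[OF le(2)] unfolding eq by simp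
  next
    case 2
    then show ?thesis using top[OF le(1)] top[OF le(2)] unfolding eq by simp
  next
    case 3
    then show ?thesis using mid[OF le(1) 3] mid[OF le(2) 3] unfolding eq by simp
  qed
qed

lemma card_generating_set_ge:
  assumes n: "n \<ge> 2" and A: "A \<subseteq> carrier (PIO n)" "finite A"
    "submonoid_generated (PIO n) A = carrier (PIO n)"
  shows "n + 1 \<le> card A"
proof -
  have "(\<lambda>i. map_kernel (gen n i)) ` {0..n} \<subseteq> map_kernel ` A"
  proof
    fix K assume "K \<in> (\<lambda>i. map_kernel (gen n i)) ` {0..n}"
    then obtain i where i: "i \<le> n" "K = map_kernel (gen n i)" by auto
    have card: "card (ran (gen n i)) = n - 1" using card_ran_gen n i by simp
    have "ran \<one>\<^bsub>PIO n\<^esub> = {1..n}" by (auto simp: one_PIO ran_def pmap_eq_Some_iff)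
    then have "gen n i \<noteq> \<one>\<^bsub>PIO n\<^esub>" using card n by auto
    then obtain a where "a \<in> A" "map_kernel a = map_kernel (gen n i)"
      using kernel_of_generator[OF A(1,3) gen_in_PIO, of i] card by auto
    then show "K \<in> map_kernel ` A" using i by auto
  qed
  then have "card ((\<lambda>i. map_kernel (gen n i)) ` {0..n}) \<le> card (map_kernel ` A)"
    using A(2) by (intro card_mono) auto
  also have "\<dots> \<le> card A" using A(2) by (rule card_image_le)
  finally show ?thesis using inj_on_kernel_gen[OF n] by (simp add: card_image)
qed

theorem theorem11:
  fixes n :: nat
  assumes "n \<ge> 2"
  shows "monoid_rank (PIO n) = n + 1"
  unfolding monoid_rank_def
proof (rule Least_equality)
  have "inj_on (gen n) {0..n}"
    using inj_on_kernel_gen[OF assms] by (auto simp: inj_on_def)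
  then have "card (gen n ` {0..n}) = n + 1" by (simp add: card_image)
  then show "\<exists>A. A \<subseteq> carrier (PIO n) \<and> finite A \<and> card A = n + 1 \<and>
      submonoid_generated (PIO n) A = carrier (PIO n)"
    using gens_generate_PIO[OF assms] gen_in_PIO by (intro exI[of _ "gen n ` {0..n}"]) auto
next
  fix k assume "\<exists>A. A \<subseteq> carrier (PIO n) \<and> finite A \<and> card A = k \<and>
      submonoid_generated (PIO n) A = carrier (PIO n)"
  then show "n + 1 \<le> k" using card_generating_set_ge[OF assms] by blast
qed

end
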